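(* For all integers $n\ge 36$ and $4\le k\le \frac n6-2$, there exists a feasible simple heterogeneous PV graph $\vec G_R$ with $n$ sites and $k$ carriers such that $$\mathcal M(\vec G_R)\ \ge\ \tfrac1{16}\,(k-3)\,(n^2-2n)^2 .$$ (This holds even though the agent knows $\vec G_R$ and $k$ and has unlimited memory.)
   Context: A PV (periodically varying) system consists of a finite set $S$ of $n$ sites and a set $C$ of $k\le n$ carriers. Each carrier $c$ has a route $\pi(c)=\langle x_0,\dots,x_{p(c)-1}\rangle$, a finite sequence of sites of length $p(c)\ge1$ called its period; $\pi(c)[j]=x_{j\bmod p(c)}$. At each time $t\in\mathbb N$ carrier $c$ is at $\pi(c)[t]$ and moves to $\pi(c)[t+1]$. The PV graph $\vec G_R$ is the directed edge-labelled multigraph on $S$ with edges $(x_i,x_{i+1},i)$, $0\le i<p(c)$, for every carrier. The system is homogeneous if all $p(c)$ are equal, heterogeneous otherwise. A route is simple if $\pi(c)[i]\ne\pi(c)[i+1]$ for all $i$ and, whenever $\pi(c)[i]=\pi(c)[j]$ with $0\le i<j<p(c)$, then $\pi(c)[i+1]\ne\pi(c)[j+1]$ (no self-loops and no repeated directed edge within one period); a PV graph is simple if all its routes are simple. An exploring agent is injected at time $0$ at a site of $\mathrm{start}(\vec G_R)=\{\pi(c)[0]:c\in C\}$; if at time $t$ it is at site $x$ it must either ride one step with some carrier $c$ with $\pi(c)[t]=x$ (one move) or halt; it cannot wait. A strategy solves PVG-Exploration of $\vec G_R$ if from every injection site the agent visits all sites and halts in finite time. $\vec G_R$ is feasible if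 from the starting point of every carrier some realizable walk visits all sites. For feasible $\vec G_R$, $\mathcal M(\vec G_R)$ denotes the minimum, over all deterministic strategies solving PVG-Exploration of $\vec G_R$ (which may use full knowledge of $\vec G_R$ and unlimited memory), of the maximum over injection sites of the number of moves performed. *)

theory Defs
  imports Complex_Main
begin

(* A PV system: a set S of sites (type nat) and a list R of routes;
   carrier c (for c < length R) has route R!c, period p(c) = length (R!c). *)

definition period :: "nat list list \<Rightarrow> nat \<Rightarrow> nat" where
  "period R c = length (R ! c)"

definition pos :: "nat list list \<Rightarrow> nat \<Rightarrow> nat \<Rightarrow> nat" where
  "pos R c t = (R ! c) ! (t mod length (R ! c))"

definition pv_system :: "nat set \<Rightarrow> nat list list \<Rightarrow> bool" where
  "pv_system S R \<longleftrightarrow> finite S \<and> length R \<le> card S \<and>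
     (\<forall>c < length R. R ! c \<noteq> [] \<and> set (R ! c) \<subseteq> S)"

definition start :: "nat list list \<Rightarrow> nat set" where
  "start R = {pos R c 0 | c. c < length R}"

definition simple_route :: "nat list list \<Rightarrow> nat \<Rightarrow> bool" where
  "simple_route R c \<longleftrightarrow>
     (\<forall>i < period R c. pos R c i \<noteq> pos R c (Suc i)) \<and>
     (\<forall>i j. i < j \<and> j < period R c \<and> pos R c i = pos R c j
        \<longrightarrow> pos R c (Suc i) \<noteq> pos R c (Suc j))"

definition simple_pv :: "nat list list \<Rightarrow> bool" where
  "simple_pv R \<longleftrightarrow> (\<forall>c < length R. simple_route R c)"

definition heterogeneous :: "nat list list \<Rightarrow> bool" where
  "heterogeneous R \<longleftrightarrow> (\<exists>c < length R. \<exists>c' < length R. period R c \<noteq> period R c')"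

fun walk_ok :: "nat list list \<Rightarrow> nat \<Rightarrow> nat \<Rightarrow> nat list \<Rightarrow> bool" where
  "walk_ok R t x [] = True"
| "walk_ok R t x (c # cs) =
     (c < length R \<and> pos R c t = x \<and> walk_ok R (Suc t) (pos R c (Suc t)) cs)"

fun visited :: "nat list list \<Rightarrow> nat \<Rightarrow> nat \<Rightarrow> nat list \<Rightarrow> nat set" where
  "visited R t x [] = {x}"
| "visited R t x (c # cs) = insert x (visited R (Suc t) (pos R c (Suc t)) cs)"

definition feasible :: "nat set \<Rightarrow> nat list list \<Rightarrow> bool" where
  "feasible S R \<longleftrightarrow>
     (\<forall>x \<in> start R. \<exists>cs. walk_ok R 0 x cs \<and> S \<subseteq> visited R 0 x cs)"

(* A deterministic strategy with full knowledge of the PV graph: since the system is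
   deterministic, its behaviour from each injection site is a finite move sequence. *)
definition solves :: "nat set \<Rightarrow> nat list list \<Rightarrow> (nat \<Rightarrow> nat list) \<Rightarrow> bool" where
  "solves S R \<sigma> \<longleftrightarrow>
     (\<forall>x \<in> start R. walk_ok R 0 x (\<sigma> x) \<and> S \<subseteq> visited R 0 x (\<sigma> x))"

definition min_moves :: "nat set \<Rightarrow> nat list list \<Rightarrow> nat" where
  "min_moves S R = (LEAST m. \<exists>\<sigma>. solves S R \<sigma> \<and> (\<forall>x \<in> start R. length (\<sigma> x) \<le> m))"

end

theory Submission
  imports Defs
begin

text \<open>The carriers form a chain in which \<open>c\<close> can only be exchanged for \<open>c - 1\<close> and \<open>c + 1\<close>.
  Away from a few special sites, even-numbered carriers are in a set \<open>X\<close> at even and in a disjoint set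
  \<open>Y\<close> at odd times, odd-numbered ones the other way round, so carriers of different parity do not meet;
  carriers of equal parity follow translates of the same Eulerian circuit of a complete bipartite digraph
  and do not meet either. The periods are \<open>2 m\<^sup>2\<close> and \<open>2 (m - 1)\<^sup>2\<close>. Carriers \<open>c - 1\<close> and \<open>c\<close> share
  one special site, each at position \<open>3 c\<close> of its route, hence they meet exactly at the times congruent to
  \<open>3 c\<close> modulo \<open>L = 2 m\<^sup>2 (m - 1)\<^sup>2\<close>. An agent that descends from carrier \<open>c\<close> to \<open>c - 1\<close> at such a time
  has just missed the meeting of \<open>c - 1\<close> with \<open>c - 2\<close> and waits almost \<open>L\<close> steps for the next one. One
  site is visited by carrier \<open>0\<close> only, so starting on carrier \<open>k - 1\<close> costs at least \<open>(k - 2) L\<close> moves.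
  Two links of different parity can share a special site, which leaves \<open>m\<close> about \<open>11 n / 24\<close> and
  \<open>L\<close> at least \<open>(n\<^sup>2 - 2 n)\<^sup>2 / 16\<close>.\<close>

section \<open>Preliminaries on arithmetic and on \<open>min_moves\<close>\<close>

lemma same_link:
  fixes i j :: nat
  assumes "(i + 1) div 2 = (j + 1) div 2" "even i = even j"
  shows "i = j"
  using assms by presburger

lemma dvd_of_mod:
  fixes t p r :: nat
  assumes "t mod p = r" shows "int p dvd int t - int r"
  using assms by (metis dvd_minus_mod of_nat_dvd_iff of_nat_diff mod_less_eq_dividend)

lemma head_visited: "x \<in> visited R t x cs"
  by (cases cs) auto

text \<open>\<open>LEAST\<close> is meaningful only once some bound exists: feasibility gives a
  strategy, finiteness of \<open>start R\<close> a maximum over it.\<close>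

lemma min_moves_ge:
  assumes fe: "feasible S R" and x: "x \<in> start R"
    and len: "\<And>cs. walk_ok R 0 x cs \<Longrightarrow> S \<subseteq> visited R 0 x cs \<Longrightarrow> b \<le> length cs"
  shows "b \<le> min_moves S R"
proof -
  let ?P = "\<lambda>l. \<exists>\<sigma>. solves S R \<sigma> \<and> (\<forall>x \<in> start R. length (\<sigma> x) \<le> l)"
  obtain \<sigma> where \<sigma>: "solves S R \<sigma>"
    using fe unfolding feasible_def solves_def by metis
  have "finite (start R)" unfolding start_def by simp
  then have "?P (Max ((length \<circ> \<sigma>) ` start R))"
    using \<sigma> by (intro exI[of _ \<sigma>]) auto
  then have "?P (min_moves S R)" unfolding min_moves_def by (rule LeastI)
  then obtain \<tau> where "solves S R \<tau>" "length (\<tau> x) \<le> min_moves S R" using x by blast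
  then show ?thesis using len[of "\<tau> x"] x by (auto simp: solves_def)
qed

section \<open>Construction of the routes\<close>

locale carrier_chain =
  fixes m k N :: nat
  assumes k_ge: "4 \<le> k" and m_ge: "2 * k + 4 \<le> m" and N_ge: "2 * m \<le> N" and N_le: "N \<le> 2 * m + 1"
begin

definition modulus :: "nat \<Rightarrow> nat" where
  "modulus c = (if even c then m else m - 1)"

definition per :: "nat \<Rightarrow> nat" where
  "per c = 2 * (modulus c * modulus c)"

text \<open>Step \<open>t\<close> of the circuit uses the edges \<open>x \<rightarrow> x + d \<rightarrow> x + 1\<close> with \<open>x = t\<close> and \<open>d = t div modulus c\<close>
  (modulo \<open>modulus c\<close>); \<open>c\<close> is the translation.\<close>

definition phase :: "nat \<Rightarrow> nat \<Rightarrow> nat" where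
  "phase c u = (if even u then u div 2 else u div 2 + u div 2 div modulus c) + c"

text \<open>The upper block of an odd carrier ends at \<open>N - 1\<close> rather than starting at
  \<open>m\<close>; this covers site \<open>2 * m\<close> when \<open>N = 2 * m + 1\<close>.\<close>

definition base :: "nat \<Rightarrow> nat \<Rightarrow> nat" where
  "base c u = (if even (c + u) then 0 else if even c then m else N - modulus c) + phase c u mod modulus c"

text \<open>The link between carriers \<open>j - 1\<close> and \<open>j\<close> is site \<open>N + (j + 1) div 2\<close> at position \<open>3 j\<close>. Links
  \<open>2 i - 1\<close> and \<open>2 i\<close> share a site, used at different parities of time; links \<open>0\<close> and \<open>k\<close> belong to a
  single carrier each.\<close>

definition special :: "nat \<Rightarrow> nat \<Rightarrow> bool" where
  "special c u \<longleftrightarrow> u = 3 * c \<or> u = 3 * c + 3"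

definition site :: "nat \<Rightarrow> nat \<Rightarrow> nat" where
  "site c u = (if special c u then N + (u div 3 + 1) div 2 else base c u)"

definition routes :: "nat list list" where
  "routes = map (\<lambda>c. map (site c) [0..<per c]) [0..<k]"

definition sites :: "nat set" where
  "sites = {..<N + (k + 1) div 2 + 1}"

definition meet_period :: nat where
  "meet_period = 2 * (m * m) * ((m - 1) * (m - 1))"

lemma m_ge12: "m \<ge> 12"
  using k_ge m_ge by linarith

lemma modulus_bounds: "2 * k + 3 \<le> modulus c" "modulus c \<le> m"
  using m_ge by (auto simp: modulus_def)

lemma modulus_ge11: "modulus c \<ge> 11"
  using modulus_bounds(1)[of c] k_ge by linarith

lemma per_bound: "6 * k + 9 < per c"
proof -
  have "11 * (2 * k + 3) \<le> modulus c * modulus c"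
    using modulus_bounds(1)[of c] modulus_ge11[of c] by (intro mult_mono) auto
  then have "2 * (11 * (2 * k + 3)) \<le> per c" unfolding per_def by (rule mult_le_mono2)
  then show ?thesis using k_ge by simp
qed

lemma per_pos [simp]: "per c > 0"
  using per_bound[of c] by linarith

lemma even_per [simp]: "even (per c)"
  by (simp add: per_def)

lemma length_routes [simp]: "length routes = k"
  by (simp add: routes_def)

lemma period_routes: "c < k \<Longrightarrow> period routes c = per c"
  by (simp add: period_def routes_def)

lemma pos_routes: "c < k \<Longrightarrow> pos routes c t = site c (t mod per c)"
  by (simp add: pos_def routes_def)

lemma parity_mod_per: "even (t mod per c) = even t"
  by (simp add: dvd_mod_iff)

lemma base_less: "base c u < N"
proof -
  have "phase c u mod modulus c < modulus c"
    using modulus_ge11[of c] by (intro mod_less_divisor) linarith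
  then show ?thesis
    using modulus_bounds(2)[of c] N_ge by (auto simp: base_def modulus_def)
qed

lemma base_less_m_iff: "base c u < m \<longleftrightarrow> even (c + u)"
proof -
  have "phase c u mod modulus c < modulus c"
    using modulus_ge11[of c] by (intro mod_less_divisor) linarith
  then show ?thesis
    using modulus_bounds(2)[of c] N_ge by (auto simp: base_def modulus_def)
qed

lemma site_ge_N_iff: "N \<le> site c u \<longleftrightarrow> special c u"
  using base_less[of c u] by (simp add: site_def)

section \<open>Special sites and meetings of carriers\<close>

lemma special_link:
  assumes "special c u"
  obtains j where "u = 3 * j" "j = c \<or> j = Suc c" "site c u = N + (j + 1) div 2"
  using assms that[of c] that[of "Suc c"] by (auto simp: special_def site_def)

text \<open>Two links sharing a special site have opposite parity, and so have their
  positions.\<close>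

lemma special_inj:
  assumes "special c u" "special c' u'" "site c u = site c' u'" "even u = even u'"
  shows "u = u'"
proof -
  obtain i where i: "u = 3 * i" "site c u = N + (i + 1) div 2" using assms(1) by (rule special_link)
  obtain j where j: "u' = 3 * j" "site c' u' = N + (j + 1) div 2" using assms(2) by (rule special_link)
  have "(i + 1) div 2 = (j + 1) div 2" using i j assms(3) by simp
  moreover have "even i = even j" using i j assms(4) by simp
  ultimately show ?thesis using same_link i j by blast
qed

text \<open>At an ordinary site the block reveals the parity of \<open>c + u\<close>, so both
  carriers have the same parity, modulus and position. Their phases then differ by
  \<open>c' - c\<close>, which lies strictly between 0 and the modulus. Only special sites
  remain.\<close>

lemma meeting:
  assumes "c < c'" "c' < k" and eq: "pos routes c t = pos routes c' t"
  shows "c' = Suc c" "t mod per c = 3 * c'" "t mod per c' = 3 * c'"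
proof -
  define u u' where "u = t mod per c" and "u' = t mod per c'"
  have s: "site c u = site c' u'" using assms by (simp add: pos_routes u_def u'_def)
  have par: "even u = even u'" by (simp add: u_def u'_def parity_mod_per)
  have "special c u"
  proof (rule ccontr)
    assume ns: "\<not> special c u"
    then have ns': "\<not> special c' u'" using s site_ge_N_iff by metis
    have b: "base c u = base c' u'" using s ns ns' by (simp add: site_def)
    then have "even (c + u) = even (c' + u')" using base_less_m_iff by metis
    then have pc: "even c = even c'" using par by simp blast
    then have md: "modulus c = modulus c'" by (simp add: modulus_def)
    then have "u = u'" by (simp add: u_def u'_def per_def)
    then have "phase c u mod modulus c = phase c' u mod modulus c"
      using b pc md by (auto simp: base_def split: if_splits)
    moreover define a where "a = (if even u then u div 2 else u div 2 + u div 2 div modulus c)"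
    ultimately have "(a + c) mod modulus c = (a + c') mod modulus c"
      using md by (simp add: phase_def)
    then have "(int a + int c) mod int (modulus c) = (int a + int c') mod int (modulus c)"
      by (metis of_nat_add of_nat_mod)
    then have "int c mod int (modulus c) = int c' mod int (modulus c)"
      by (simp add: mod_eq_dvd_iff)
    then show False using assms modulus_bounds(1)[of c] by simp
  qed
  moreover from this have "special c' u'" using s site_ge_N_iff by metis
  ultimately have "u = u'" using special_inj s par by blast
  then show "c' = Suc c" "t mod per c = 3 * c'" "t mod per c' = 3 * c'"
    using \<open>special c u\<close> \<open>special c' u'\<close> \<open>c < c'\<close> by (auto simp: special_def u_def u'_def)
qed

lemma per_dvd_meet_period: "per c dvd meet_period"
  by (auto simp: per_def meet_period_def modulus_def)

lemma meet_period_pos: "meet_period > 0"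
  using m_ge12 by (simp add: meet_period_def)

lemma meet_period_gt: "3 * k < meet_period"
  using dvd_imp_le[OF per_dvd_meet_period meet_period_pos, of 0] per_bound[of 0] by linarith

text \<open>Both periods are even; once the common factor 2 is split off, the squares of
  \<open>m\<close> and \<open>m - 1\<close> are coprime.\<close>

lemma meet_period_dvd:
  fixes a :: int
  assumes "int (per c) dvd a" "int (per (Suc c)) dvd a"
  shows "int meet_period dvd a"
proof -
  have d: "int (2 * (m * m)) dvd a" "int (2 * ((m - 1) * (m - 1))) dvd a"
    using assms by (auto simp: per_def modulus_def split: if_splits)
  then obtain b where b: "a = 2 * b" by (auto elim!: dvdE)
  have "int (m * m) dvd b" "int ((m - 1) * (m - 1)) dvd b" using d b by auto
  moreover have "coprime m (m - 1)"
    using m_ge12 coprime_Suc_left_nat[of "m - 1"] by simp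
  then have "coprime (int (m * m)) (int ((m - 1) * (m - 1)))"
    by (simp only: coprime_int_iff) simp
  ultimately have "int (m * m) * int ((m - 1) * (m - 1)) dvd b" by (rule divides_mult)
  then show ?thesis using b by (auto simp: meet_period_def mult.assoc)
qed

lemma meeting_time:
  assumes "c < c'" "c' < k" "pos routes c t = pos routes c' t"
  shows "c' = Suc c" "int meet_period dvd int t - 3 * int c'"
proof -
  note mt = meeting[OF assms]
  show "c' = Suc c" by (rule mt)
  have "int (per c) dvd int t - int (3 * c')" by (rule dvd_of_mod[OF mt(2)])
  moreover have "int (per (Suc c)) dvd int t - int (3 * c')"
    unfolding mt(1)[symmetric] by (rule dvd_of_mod[OF mt(3)])
  ultimately show "int meet_period dvd int t - 3 * int c'"
    using meet_period_dvd[of c "int t - int (3 * c')"] by simp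
qed

lemma pos_at_meeting:
  assumes "Suc c < k"
  shows "pos routes c (3 * Suc c + a * meet_period) = pos routes (Suc c) (3 * Suc c + a * meet_period)"
proof -
  have "(3 * Suc c + a * meet_period) mod per d = 3 * Suc c" for d
  proof -
    have "per d dvd a * meet_period" using per_dvd_meet_period by (rule dvd_mult)
    then have "(3 * Suc c + a * meet_period) mod per d = (3 * Suc c) mod per d"
      by (auto elim!: dvdE)
    then show ?thesis using per_bound[of d] assms by simp
  qed
  then show ?thesis using assms by (simp add: pos_routes site_def special_def)
qed

section \<open>Lower bound on the exploration time\<close>

lemma visiting_N:
  assumes "c < k" "pos routes c t = N"
  shows "c = 0"
proof -
  have "special c (t mod per c)" using assms site_ge_N_iff[of c "t mod per c"] by (simp add: pos_routes)
  then show ?thesis using assms by (auto elim!: special_link simp: pos_routes)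
qed

text \<open>An agent that starts on carrier \<open>k - 1\<close> needs at least this much time to board carrier \<open>c\<close>:
  each change to the next lower carrier happens three steps too late for the following one.\<close>

definition boarding_time :: "nat \<Rightarrow> int" where
  "boarding_time c = 3 * (int c + 1) + (int k - 2 - int c) * int meet_period"

lemma boarding_step:
  assumes c: "c < k" "c' < k" and t: "boarding_time c \<le> int t"
    and eq: "pos routes c (Suc t) = pos routes c' (Suc t)"
  shows "boarding_time c' \<le> int (Suc t)"
proof -
  let ?L = "int meet_period"
  consider "c' = c" | "c < c'" | "c' < c" by linarith
  then show ?thesis
  proof cases
    case 2
    then have "c' = Suc c" using meeting_time c eq by blast
    moreover have "boarding_time (Suc c) \<le> boarding_time c"
      using meet_period_gt k_ge by (simp add: boarding_time_def algebra_simps)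
    ultimately show ?thesis using t by simp
  next
    case 3
    then have cc: "c = Suc c'" and "?L dvd int (Suc t) - 3 * int c"
      using meeting_time[of c' c "Suc t"] c eq by auto
    then obtain a where a: "int (Suc t) = 3 * int c + ?L * a" by (metis dvdE diff_eq_eq add.commute)
    \<comment> \<open>\<open>boarding_time c\<close> is 3 more than \<open>3 * int c\<close> plus
      \<open>int k - 2 - int c\<close> periods, so the inequality is strict and integrality gains a
      full period.\<close>
    have "(int k - 2 - int c) * ?L < a * ?L"
      using t a by (simp add: boarding_time_def algebra_simps)
    then have "int k - 2 - int c < a" using meet_period_pos by (simp add: mult_less_cancel_right)
    then have "(int k - 1 - int c) * ?L \<le> a * ?L" by (intro mult_right_mono) auto
    then show ?thesis using a cc by (simp add: boarding_time_def algebra_simps)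
  qed (use t in simp)
qed

text \<open>The invariant ranges over all carriers present at \<open>x\<close>, since the agent may
  board any of them. At \<open>N\<close> this can only be carrier 0.\<close>

lemma walk_time_bound:
  assumes "walk_ok routes t x cs" "N \<in> visited routes t x cs"
    and "\<exists>c<k. pos routes c t = x"
    and "\<And>c. c < k \<Longrightarrow> pos routes c t = x \<Longrightarrow> boarding_time c \<le> int t"
  shows "boarding_time 0 \<le> int (t + length cs)"
  using assms
proof (induction cs arbitrary: t x)
  case Nil
  then obtain c where c: "c < k" "pos routes c t = N" by auto
  then have "c = 0" by (rule visiting_N)
  then show ?case using Nil c by auto
next
  case (Cons c cs)
  show ?case
  proof (cases "x = N")
    case True
    then have "boarding_time 0 \<le> int t" using Cons.prems visiting_N by blast
    then show ?thesis by simp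
  next
    case False
    have c: "c < k" "pos routes c t = x" using Cons.prems(1) by auto
    have "boarding_time 0 \<le> int (Suc t + length cs)"
    proof (rule Cons.IH)
      show "walk_ok routes (Suc t) (pos routes c (Suc t)) cs" using Cons.prems(1) by simp
      show "N \<in> visited routes (Suc t) (pos routes c (Suc t)) cs" using Cons.prems(2) False by auto
      show "\<exists>c'<k. pos routes c' (Suc t) = pos routes c (Suc t)" using c by blast
      show "boarding_time c' \<le> int (Suc t)"
        if "c' < k" "pos routes c' (Suc t) = pos routes c (Suc t)" for c'
        using boarding_step[of c c' t] Cons.prems(4)[of c] c that by auto
    qed
    then show ?thesis by simp
  qed
qed

lemma exploration_length:
  assumes "walk_ok routes 0 (pos routes (k - 1) 0) cs" "sites \<subseteq> visited routes 0 (pos routes (k - 1) 0) cs"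
  shows "(k - 2) * meet_period \<le> length cs"
proof -
  have "boarding_time 0 \<le> int (0 + length cs)"
  proof (rule walk_time_bound)
    show "walk_ok routes 0 (pos routes (k - 1) 0) cs" by fact
    show "N \<in> visited routes 0 (pos routes (k - 1) 0) cs"
      using assms(2) by (auto simp: sites_def)
    show "\<exists>c<k. pos routes c 0 = pos routes (k - 1) 0" using k_ge by (intro exI[of _ "k - 1"]) auto
    \<comment> \<open>Only carrier \<open>k - 1\<close> is at the starting site at time 0, as its
      meetings with lower carriers need position \<open>3 * (k - 1)\<close>. Its
      \<open>boarding_time\<close> is \<open>3 * k - meet_period\<close>, a negative
      integer.\<close>
    show "boarding_time c \<le> int 0" if c: "c < k" "pos routes c 0 = pos routes (k - 1) 0" for c
    proof (cases "c = k - 1")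
      case True
      then show ?thesis using k_ge meet_period_gt by (simp add: boarding_time_def of_nat_diff)
    next
      case False
      then have "c < k - 1" using c by simp
      then have "0 mod per c = 3 * (k - 1)" using meeting(2)[of c "k - 1" 0] c k_ge by simp
      then show ?thesis using k_ge by simp
    qed
  qed
  then have "int ((k - 2) * meet_period) \<le> int (length cs)"
    using k_ge by (simp add: boarding_time_def of_nat_diff)
  then show ?thesis by (simp only: of_nat_le_iff)
qed

section \<open>Simplicity of the routes\<close>

lemma base_per: "base c (per c) = base c 0"
  by (simp add: base_def phase_def per_def)

text \<open>With \<open>w = modulus c\<close> and \<open>a = i div 2\<close>, the endpoints of an
  edge of either direction determine \<open>a\<close> and \<open>a + a div w\<close> modulo
  \<open>w\<close>, hence both base-\<open>w\<close> digits of \<open>a < w * w\<close>.\<close>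

lemma base_edge_inj:
  assumes ij: "i < per c" "j < per c" "even i = even j"
    and eq: "base c i = base c j" "base c (Suc i) = base c (Suc j)"
  shows "i = j"
proof -
  define w a b where "w = modulus c" and "a = i div 2" and "b = j div 2"
  have w: "w > 0" using modulus_ge11[of c] by (simp add: w_def)
  have ab: "a < w * w" "b < w * w" using ij by (auto simp: a_def b_def per_def w_def)
  have ph: "phase c i mod w = phase c j mod w" "phase c (Suc i) mod w = phase c (Suc j) mod w"
    using eq ij(3) by (auto simp: base_def w_def split: if_splits)
  have mods: "(a + c) mod w = (b + c) mod w" "(a + a div w + c) mod w = (b + b div w + c) mod w"
    if "even i"
    using ph ij(3) that by (auto simp: phase_def a_def b_def w_def)
  have mods': "(Suc a + c) mod w = (Suc b + c) mod w" "(a + a div w + c) mod w = (b + b div w + c) mod w"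
    if "odd i"
    using ph ij(3) that by (auto simp: phase_def a_def b_def w_def)
  have m1: "int w dvd int a - int b"
  proof (cases "even i")
    case True
    then have "(int a + int c) mod int w = (int b + int c) mod int w"
      using mods(1) by (metis of_nat_add of_nat_mod)
    then show ?thesis by (simp add: mod_eq_dvd_iff)
  next
    case False
    then have "(int (Suc a) + int c) mod int w = (int (Suc b) + int c) mod int w"
      using mods'(1) by (metis of_nat_add of_nat_mod)
    then show ?thesis by (simp add: mod_eq_dvd_iff)
  qed
  have "(int a + int (a div w) + int c) mod int w = (int b + int (b div w) + int c) mod int w"
    using mods(2) mods'(2) by (metis of_nat_add of_nat_mod)
  then have "int w dvd (int a - int b) + (int (a div w) - int (b div w))"
    by (simp add: mod_eq_dvd_iff algebra_simps)
  then have "int w dvd int (a div w) - int (b div w)"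
    using m1 dvd_add_right_iff by blast
  then have "a div w mod w = b div w mod w"
    by (metis mod_eq_dvd_iff of_nat_mod of_nat_eq_iff)
  moreover have "a div w < w" "b div w < w" using ab w by (auto simp: less_mult_imp_div_less)
  ultimately have "a div w = b div w" by simp
  moreover have "a mod w = b mod w" using m1 by (metis mod_eq_dvd_iff of_nat_mod of_nat_eq_iff)
  ultimately have "a = b" by (metis div_mult_mod_eq)
  then show ?thesis using ij(3) unfolding a_def b_def by presburger
qed

text \<open>Special positions are never adjacent, so one endpoint is ordinary and its block fixes
  the parity. A special endpoint then fixes the position; without one, the edge belongs to the
  underlying circuit.\<close>

lemma site_edge_inj:
  assumes c: "c < k" and ij: "i < per c" "j < per c"
    and eq: "site c i = site c j" "site c (Suc i mod per c) = site c (Suc j mod per c)"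
  shows "i = j"
proof -
  define i' j' where "i' = Suc i mod per c" and "j' = Suc j mod per c"
  have par': "even i' = odd i" "even j' = odd j" by (simp_all add: i'_def j'_def parity_mod_per)
  have e': "site c i' = site c j'" using eq by (simp add: i'_def j'_def)
  have sp: "special c i = special c j" "special c i' = special c j'"
    using eq(1) e' site_ge_N_iff by metis+
  have not_both: "\<not> (special c i \<and> special c i')"
    using ij(1) per_bound[of c] c unfolding special_def i'_def mod_Suc by (auto split: if_splits)
  have base_par: "even u = even v" if "site c u = site c v" "\<not> special c u" "\<not> special c v" for u v
    using that base_less_m_iff[of c u] base_less_m_iff[of c v] by (auto simp: site_def)
  have par: "even i = even j"
    using not_both sp base_par[OF eq(1)] base_par[OF e'] par' by blast
  have suc_inj: "i = j" if "i' = j'"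
    using that ij by (auto simp: i'_def j'_def mod_Suc split: if_splits)
  consider "special c i" | "special c i'" | "\<not> special c i" "\<not> special c i'" by blast
  then show ?thesis
  proof cases
    case 1
    then show ?thesis using special_inj eq(1) sp par by blast
  next
    case 2
    then have "i' = j'" using special_inj e' sp par par' by blast
    then show ?thesis by (rule suc_inj)
  next
    case 3
    have suc: "base c (Suc u mod per c) = base c (Suc u)" if "u < per c" for u
      using that base_per by (cases "Suc u = per c") auto
    have "base c i = base c j" "base c i' = base c j'"
      using 3 sp eq(1) e' by (auto simp: site_def)
    then show ?thesis
      using base_edge_inj[OF ij par] suc ij by (simp add: i'_def j'_def)
  qed
qed

lemma site_no_loop:
  assumes "c < k" "i < per c"
  shows "site c i \<noteq> site c (Suc i mod per c)"
proof
  define i' where "i' = Suc i mod per c"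
  assume "site c i = site c (Suc i mod per c)"
  then have e: "site c i = site c i'" by (simp add: i'_def)
  then have "special c i = special c i'" using site_ge_N_iff by metis
  moreover have "\<not> (special c i \<and> special c i')"
    using assms per_bound[of c] unfolding special_def i'_def mod_Suc by (auto split: if_splits)
  ultimately have "base c i = base c i'" using e by (auto simp: site_def)
  then have "even (c + i) = even (c + i')" using base_less_m_iff by metis
  then show False by (simp add: i'_def parity_mod_per) blast
qed

lemma simple_routes: "simple_pv routes"
  unfolding simple_pv_def simple_route_def
proof (intro allI impI conjI)
  fix c i assume "c < length routes" "i < period routes c"
  then show "pos routes c i \<noteq> pos routes c (Suc i)"
    using site_no_loop[of c i] by (simp add: pos_routes period_routes)
next
  fix c i j assume "c < length routes" "i < j \<and> j < period routes c \<and> pos routes c i = pos routes c j"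
  then show "pos routes c (Suc i) \<noteq> pos routes c (Suc j)"
    using site_edge_inj[of c i j] by (auto simp: pos_routes period_routes)
qed

section \<open>Coverage of all sites and feasibility\<close>

lemma site_in_sites:
  assumes "c < k" shows "site c u \<in> sites"
proof (cases "special c u")
  case True
  then obtain j where "j = c \<or> j = Suc c" "site c u = N + (j + 1) div 2" by (rule special_link)
  then have "site c u = N + (j + 1) div 2" "j + 1 \<le> k + 1" using assms by auto
  then show ?thesis using div_le_mono[of "j + 1" "k + 1" 2] by (simp add: sites_def)
next
  case False
  then show ?thesis using base_less[of c u] by (simp add: site_def sites_def)
qed

lemma site_covered:
  assumes "v \<in> sites"
  shows "\<exists>c<k. \<exists>u<per c. site c u = v"
proof -
  have m0: "modulus 0 = m" by (simp add: modulus_def)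
  have mm: "6 * m \<le> per 0" using m_ge12 by (simp add: per_def m0)
  consider "v < m" | "m \<le> v" "v < 2 * m" | "v = 2 * m" "N = 2 * m + 1" | "N \<le> v"
    using N_le N_ge by linarith
  then show ?thesis
  proof cases
    case 1
    \<comment> \<open>The second lap of carrier 0 stays clear of its special positions 0 and
      3.\<close>
    have "2 * (m + v) < per 0" using 1 mm by simp
    moreover have "site 0 (2 * (m + v)) = v"
      using 1 m_ge12 by (auto simp: site_def special_def base_def phase_def m0)
    ultimately show ?thesis using k_ge by (metis not_numeral_le_zero not_gr_zero)
  next
    case 2
    \<comment> \<open>Again the second lap, where the offset is 1: \<open>t + 1\<close> has to be
      congruent to \<open>v\<close> modulo \<open>m\<close>.\<close>
    define t where "t = (if v = m then 2 * m - 1 else v - 1)"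
    have t: "m \<le> t" "t < 2 * m" "(t + 1) mod m = v - m"
      using 2 m_ge12 by (auto simp: t_def mod_if)
    then have "t div m = 1" by (simp add: div_nat_eqI)
    then have "site 0 (2 * t + 1) = v"
      using 2 t m_ge12 by (auto simp: site_def special_def base_def phase_def m0)
    moreover have "2 * t + 1 < per 0" using t mm by linarith
    ultimately show ?thesis using k_ge by (metis not_numeral_le_zero not_gr_zero)
  next
    case 3
    define w where "w = m - 1"
    have m1: "modulus 1 = w" by (simp add: modulus_def w_def)
    have w: "w \<ge> 11" "m = w + 1" using m_ge12 by (auto simp: w_def)
    \<comment> \<open>The translation of carrier 1 gives phase \<open>w - 1\<close> here, the last
      site of its upper block.\<close>
    have "\<not> special 1 (2 * (w - 2))" using w(1) unfolding special_def by auto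
    moreover have "phase 1 (2 * (w - 2)) mod w = w - 1" using w(1) by (simp add: phase_def)
    then have "base 1 (2 * (w - 2)) = N - w + (w - 1)" unfolding base_def m1 by simp
    then have "base 1 (2 * (w - 2)) = v" using 3 w by linarith
    ultimately have "site 1 (2 * (w - 2)) = v" by (simp add: site_def)
    moreover have "2 * w \<le> per 1" unfolding per_def m1 by (rule mult_le_mono2[OF le_square])
    then have "2 * (w - 2) < per 1" using w by simp
    moreover have "1 < k" using k_ge by simp
    ultimately show ?thesis by blast
  next
    case 4
    define i where "i = v - N"
    have i: "v = N + i" "i \<le> (k + 1) div 2" using 4 assms by (auto simp: i_def sites_def)
    show ?thesis
    proof (cases "i = 0")
      case True
      then have "site 0 0 = v" using i by (simp add: site_def special_def)
      then show ?thesis using k_ge by (intro exI[of _ 0] conjI) auto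
    next
      case False
      \<comment> \<open>Link \<open>2 * i - 1\<close> uses this site; \<open>c\<close> is its lower
        carrier.\<close>
      define c where "c = 2 * i - 2"
      have c: "c < k" "Suc (Suc c) div 2 = i" using False i(2) by (auto simp: c_def)
      have "(3 * c + 3) div 3 = Suc c" by simp
      then have "site c (3 * c + 3) = v" using c i by (simp add: site_def special_def)
      moreover have "3 * c + 3 < per c" using per_bound[of c] c by linarith
      ultimately show ?thesis using c by blast
    qed
  qed
qed

text \<open>Reachability of carrier \<open>c'\<close> at time \<open>t'\<close> in continuation form, so that transitivity is immediate
  and no operation for concatenating walks is needed.\<close>

definition leads_to :: "nat \<Rightarrow> nat \<Rightarrow> nat \<Rightarrow> nat \<Rightarrow> bool" where
  "leads_to c t c' t' \<longleftrightarrow> (\<forall>cs'. walk_ok routes t' (pos routes c' t') cs' \<longrightarrow>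
     (\<exists>cs. walk_ok routes t (pos routes c t) cs \<and>
       insert (pos routes c t) (visited routes t' (pos routes c' t') cs') \<subseteq> visited routes t (pos routes c t) cs))"

lemma leads_to_trans: "leads_to c t c' t' \<Longrightarrow> leads_to c' t' c'' t'' \<Longrightarrow> leads_to c t c'' t''"
  unfolding leads_to_def by (meson insert_subset subset_trans)

lemma leads_to_same_place: "pos routes c t = pos routes c' t \<Longrightarrow> leads_to c t c' t"
  unfolding leads_to_def using head_visited by auto

lemma leads_to_ride:
  assumes "c < k"
  shows "leads_to c t c (t + d)"
proof (induction d)
  case 0
  show ?case by (simp add: leads_to_same_place)
next
  case (Suc d)
  have "leads_to c (t + d) c (Suc (t + d))"
    unfolding leads_to_def
  proof (intro allI impI)
    fix cs assume "walk_ok routes (Suc (t + d)) (pos routes c (Suc (t + d))) cs"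
    then show "\<exists>cs'. walk_ok routes (t + d) (pos routes c (t + d)) cs' \<and>
        insert (pos routes c (t + d)) (visited routes (Suc (t + d)) (pos routes c (Suc (t + d))) cs)
          \<subseteq> visited routes (t + d) (pos routes c (t + d)) cs'"
      using assms by (intro exI[of _ "c # cs"]) auto
  qed
  then show ?case using leads_to_trans Suc by simp
qed

lemma leads_to_neighbour:
  assumes "Suc c < k" "{d, d'} = {c, Suc c}"
  shows "\<exists>t'. leads_to d t d' t'"
proof -
  \<comment> \<open>Adding \<open>t\<close> periods, each at least 1 long, makes this meeting no
    earlier than \<open>t\<close>.\<close>
  let ?t' = "3 * Suc c + t * meet_period"
  have "t \<le> ?t'" using meet_period_pos by (cases meet_period) auto
  moreover have "d < k" using assms by (auto simp: doubleton_eq_iff)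
  ultimately have "leads_to d t d ?t'" using leads_to_ride[of d t "?t' - t"] by simp
  moreover have "leads_to d ?t' d' ?t'"
    using leads_to_same_place pos_at_meeting[OF assms(1), of t] assms(2)
    by (auto simp: doubleton_eq_iff)
  ultimately show ?thesis using leads_to_trans by blast
qed

lemma leads_to_carrier:
  assumes "c < k" "c' < k"
  shows "\<exists>t'. leads_to c t c' t'"
proof -
  have up: "\<exists>t'. leads_to c t (c + d) t'" if "c + d < k" for c d t
    using that
  proof (induction d)
    case 0
    then show ?case using leads_to_same_place by auto
  next
    case (Suc d)
    then obtain t1 where "leads_to c t (c + d) t1" by auto
    moreover obtain t2 where "leads_to (c + d) t1 (c + Suc d) t2"
      using leads_to_neighbour[of "c + d" "c + d" "c + Suc d"] Suc.prems by auto
    ultimately show ?case using leads_to_trans by blast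
  qed
  have down: "\<exists>t'. leads_to (c + d) t c t'" if "c + d < k" for c d t
    using that
  proof (induction d arbitrary: t)
    case 0
    then show ?case using leads_to_same_place by auto
  next
    case (Suc d)
    obtain t1 where "leads_to (c + Suc d) t (c + d) t1"
      using leads_to_neighbour[of "c + d" "c + Suc d" "c + d"] Suc.prems by auto
    moreover obtain t2 where "leads_to (c + d) t1 c t2" using Suc by fastforce
    ultimately show ?case using leads_to_trans by blast
  qed
  show ?thesis
    using up[of c "c' - c" t] down[of c' "c - c'" t] assms by (cases "c \<le> c'") auto
qed

lemma leads_to_site:
  assumes "c < k" "v \<in> sites"
  shows "\<exists>c'<k. \<exists>t'. leads_to c t c' t' \<and> pos routes c' t' = v"
proof -
  obtain c' u where c': "c' < k" "u < per c'" "site c' u = v" using site_covered assms(2) by blast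
  obtain t1 where t1: "leads_to c t c' t1" using leads_to_carrier assms(1) c'(1) by blast
  let ?t' = "u + t1 * per c'"
  have "t1 \<le> ?t'" using per_pos[of c'] by (cases "per c'") auto
  then have "leads_to c' t1 c' ?t'" using leads_to_ride[of c' t1 "?t' - t1"] c' by simp
  then have "leads_to c t c' ?t'" using t1 leads_to_trans by blast
  moreover have "pos routes c' ?t' = v" using c' by (simp add: pos_routes)
  ultimately show ?thesis using c'(1) by blast
qed

lemma walk_covering:
  assumes "finite V" "V \<subseteq> sites" "c < k"
  shows "\<exists>cs. walk_ok routes t (pos routes c t) cs \<and> V \<subseteq> visited routes t (pos routes c t) cs"
  using assms
proof (induction V arbitrary: c t rule: finite_induct)
  case empty
  then show ?case by (intro exI[of _ "[]"]) auto
next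
  case (insert v V)
  obtain c' t' where c': "c' < k" "leads_to c t c' t'" "pos routes c' t' = v"
    using leads_to_site[of c v t] insert.prems by auto
  obtain cs' where cs': "walk_ok routes t' (pos routes c' t') cs'" "V \<subseteq> visited routes t' (pos routes c' t') cs'"
    using insert.IH[of c' t'] insert.prems c'(1) by auto
  then have "insert v V \<subseteq> visited routes t' (pos routes c' t') cs'"
    using c'(3) head_visited by auto
  then show ?case using c'(2) cs'(1) unfolding leads_to_def by (meson insert_subset subset_trans)
qed

lemma feasible_routes: "feasible sites routes"
  unfolding feasible_def start_def
  using walk_covering[of sites _ 0] by (auto simp: sites_def)

lemma pv_system_routes: "pv_system sites routes"
proof -
  have "routes ! c \<noteq> []" "set (routes ! c) \<subseteq> sites" if "c < k" for c
    using that per_pos[of c] site_in_sites[OF that] by (auto simp: routes_def)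
  then show ?thesis using m_ge N_ge by (auto simp: pv_system_def sites_def)
qed

lemma heterogeneous_routes: "heterogeneous routes"
proof -
  have "(m - 1) * (m - 1) < m * m" using m_ge12 by (intro mult_strict_mono) auto
  then have "period routes 0 \<noteq> period routes 1"
    using k_ge by (simp add: period_routes per_def modulus_def)
  then show ?thesis unfolding heterogeneous_def using k_ge
    by (intro exI[of _ 0] exI[of _ 1] conjI) auto
qed

lemma min_moves_routes: "(k - 2) * meet_period \<le> min_moves sites routes"
proof (rule min_moves_ge[OF feasible_routes])
  show "pos routes (k - 1) 0 \<in> start routes"
    using k_ge by (auto simp: start_def intro!: exI[of _ "k - 1"])
qed (rule exploration_length)

end

section \<open>Choice of the parameters and numerical estimate\<close>

theorem mainTheorem6:
  fixes n k :: nat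
  assumes "n \<ge> 36" and "4 \<le> k" and "real k \<le> real n / 6 - 2"
  shows "\<exists>S R. pv_system S R \<and> card S = n \<and> length R = k \<and>
           feasible S R \<and> simple_pv R \<and> heterogeneous R \<and>
           real (min_moves S R) \<ge> (real k - 3) * (real n ^ 2 - 2 * real n) ^ 2 / 16"
proof -
  have nk: "6 * k + 12 \<le> n" using assms(3) by linarith
  \<comment> \<open>\<open>h\<close> counts the special sites, \<open>N\<close> the ordinary
    ones.\<close>
  define h where "h = (k + 1) div 2 + 1"
  define N where "N = n - h"
  define m where "m = N div 2"
  have h: "2 * h \<le> k + 3" by (simp add: h_def)
  have nN: "n = N + h" using h nk by (simp add: N_def)
  \<comment> \<open>Combines \<open>N <= 2 * m + 1\<close>, \<open>2 * h <= k + 3\<close> and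
    \<open>6 * k + 12 <= n\<close>.\<close>
  have m_lower: "11 * n \<le> 24 * m + 18" using h nk nN by (simp add: m_def)
  interpret carrier_chain m k N
    by standard (use assms(2) m_lower nk in \<open>auto simp: m_def\<close>)
  have "card sites = n" by (simp add: sites_def nN h_def)
  moreover have "(real k - 3) * (real n ^ 2 - 2 * real n) ^ 2 / 16 \<le> real (min_moves sites routes)"
  proof -
    let ?A = "real n ^ 2 - 2 * real n" and ?M = "real m * (real m - 1)"
    have A0: "0 \<le> ?A" using assms(1) by (simp add: power2_eq_square)
    have mr: "(11 * real n - 18) / 24 \<le> real m"
      using m_lower of_nat_le_iff[of "11 * n" "24 * m + 18", where 'a = real] by simp
    have "(11 * real n - 18) / 24 * ((11 * real n - 18) / 24 - 1) \<le> ?M"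
      using mr assms(1) by (intro mult_mono) auto
    \<comment> \<open>576 times the difference of 28 times the previous left-hand side and
      \<open>5 * ?A\<close> is this product plus a positive constant.\<close>
    moreover have "0 \<le> (real n - 36) * (508 * real n + 5568)" using assms(1) by simp
    ultimately have AM: "5 * ?A \<le> 28 * ?M" by (simp add: field_simps power2_eq_square)
    \<comment> \<open>The ratio 28/5 is just below the square root of 32: the goal follows from 784
      <= 32 * 25.\<close>
    have "(5 * ?A)\<^sup>2 \<le> (28 * ?M)\<^sup>2" using AM A0 by (intro power_mono) auto
    then have "25 * ?A\<^sup>2 \<le> 784 * ?M\<^sup>2" by (simp only: power_mult_distrib) simp
    then have "?A\<^sup>2 / 16 \<le> 2 * ?M\<^sup>2" using zero_le_power2[of ?M] by linarith
    also have "2 * ?M\<^sup>2 = real meet_period"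
    proof -
      have "real (m - 1) = real m - 1" using m_ge12 by (simp add: of_nat_diff)
      then show ?thesis unfolding meet_period_def power2_eq_square of_nat_mult by simp
    qed
    finally have "(real k - 3) * (?A\<^sup>2 / 16) \<le> (real k - 2) * real meet_period"
      using assms(2) by (intro mult_mono) auto
    also have "\<dots> = real ((k - 2) * meet_period)" using assms(2) by (simp add: of_nat_diff)
    also have "\<dots> \<le> real (min_moves sites routes)" using min_moves_routes by (simp only: of_nat_le_iff)
    finally show ?thesis by simp
  qed
  ultimately show ?thesis
    using pv_system_routes feasible_routes simple_routes heterogeneous_routes
    by (intro exI[of _ sites] exI[of _ routes]) simp
qed

end
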